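(* For all $f\in\mathcal{L}$, $\eta\in\Omega'$ and $s,t\ge0$: (i) $|LP_sf(\eta)|\le 3\,c(f)\,e^{4a_0s}\|\eta\|$ and $|P_tf(\eta)-f(\eta)|\le(4a_0)^{-1}\,c(f)\,\|\eta\|\,(e^{4a_0t}-1)$; (ii) $\lim_{t\downarrow0}t^{-1}\big[P_tf(\eta)-f(\eta)\big]=Lf(\eta)$; (iii) $LP_tf(\eta)=P_tLf(\eta)$.
   Context: $\mathbb{N}_0=\{0,1,2,\ldots\}$. The rate $g:\mathbb{N}_0\to[0,\infty)$ satisfies $g(0)=0$, $g(k)>0$ for $k\ge1$, and $\sup_{k\ge0}|g(k+1)-g(k)|\le a_0<\infty$. $p$ is an irreducible transition probability on $\mathbb{Z}^d$ with $\lim_{x\to\infty}p(x,y)=0$ for every $y$; $p^{(n)}$ is the $n$-step transition probability. Set $\beta(x)=\sum_{n\ge0}2^{-n}p^{(n)}(x,0)$. For $\eta,\zeta\in\Omega=\mathbb{N}_0^{\mathbb{Z}^d}$ put $\|\eta-\zeta\|=\sum_x|\eta(x)-\zeta(x)|\beta(x)$, $\|\eta\|=\sum_x\eta(x)\beta(x)$, $\Omega'=\{\eta\in\Omega:\|\eta\|<\infty\}$. $\mathcal{L}$ is the set of $f:\Omega'\to\mathbb{R}$ with $|f(\eta)-f(\zeta)|\le c\|\eta-\zeta\|$ for some constant $c$ and all $\eta,\zeta\in\Omega'$; $c(f)$ is the smallest such $c$. For $f\in\mathcal{L}$, $\eta\in\Omega'$, $(Lf)(\eta)=\sum_{x,y\in\mathbb{Z}^d}p(x,x+y)g(\eta(x))[f(\eta^{x,x+y})-f(\eta)]$,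 where $\eta^{x,z}$ is $\eta$ with one particle moved from $x$ to $z$. $(P_t)_{t\ge0}$ is the infinite-volume zero-range semigroup on $\mathcal{L}$: the semigroup of linear operators on $\mathcal{L}$ such that $P_tf(\eta)=E^\eta[f(\eta_t)]$ for $f\in\mathcal{L}$ and finite $\eta$ (i.e. $\sum_x\eta(x)<\infty$; $\eta_t$ is the countable-state Markov chain with generator $L$) and, for $f\in\mathcal{L}$, $\eta,\zeta\in\Omega'$, $|P_tf(\eta)-P_tf(\zeta)|\le c(f)e^{4a_0t}\|\eta-\zeta\|$, so that $c(P_tf)\le c(f)e^{4a_0t}$; it also satisfies $P_tf(\eta)=f(\eta)+\int_0^tLP_sf(\eta)ds$. For each $\eta\in\Omega'$, $t\ge0$ there is a probability measure $P^\eta[\eta_t\in d\zeta]$ concentrated on $\Omega'$, with $\int\|\zeta\|P^\eta[\eta_t\in d\zeta]<\infty$ and $P_tf(\eta)=\int f(\zeta)P^\eta[\eta_t\in d\zeta]$ for $f\in\mathcal{L}$; in (iii), $P_tLf(\eta)$ means $\int Lf(\zeta)\,P^\eta[\eta_t\in d\zeta]$.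
   Formalization: In (i) the printed bounds fail (e.g. g(k)=4k, a_0=4, simple random walk); the formal theorem has 3a_0 c(f)e^{4a_0 s}‖η‖ in place of 3c(f)e^{4a_0 s}‖η‖, and multiplies the second bound (4a_0)^{-1}c(f)‖η‖(e^{4a_0 t}-1) by 3a_0. *)

theory Defs
  imports "HOL-Probability.Probability"
begin

type_synonym 'd site = "int ^ 'd"
type_synonym 'd config = "'d site \<Rightarrow> nat"

primrec nstep :: "('d::finite site \<Rightarrow> 'd site pmf) \<Rightarrow> nat \<Rightarrow> 'd site \<Rightarrow> 'd site pmf" where
  "nstep p 0 x = return_pmf x"
| "nstep p (Suc n) x = bind_pmf (p x) (nstep p n)"

definition beta :: "('d::finite site \<Rightarrow> 'd site pmf) \<Rightarrow> 'd site \<Rightarrow> real" where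
  "beta p x = (\<Sum>n. (1/2) ^ n * pmf (nstep p n x) 0)"

definition config_dist :: "('d::finite site \<Rightarrow> 'd site pmf) \<Rightarrow> 'd config \<Rightarrow> 'd config \<Rightarrow> real" where
  "config_dist p \<eta> \<zeta> = (\<Sum>\<^sub>\<infinity>x. \<bar>real (\<eta> x) - real (\<zeta> x)\<bar> * beta p x)"

definition config_norm :: "('d::finite site \<Rightarrow> 'd site pmf) \<Rightarrow> 'd config \<Rightarrow> real" where
  "config_norm p \<eta> = (\<Sum>\<^sub>\<infinity>x. real (\<eta> x) * beta p x)"

definition Omega' :: "('d::finite site \<Rightarrow> 'd site pmf) \<Rightarrow> 'd config set" where
  "Omega' p = {\<eta>. (\<lambda>x. real (\<eta> x) * beta p x) summable_on UNIV}"

definition finite_configs :: "'d::finite config set" where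
  "finite_configs = {\<eta>. finite {x. \<eta> x \<noteq> 0}}"

text \<open>
  Functions on \<open>\<Omega>'\<close> are total functions whose values outside \<open>\<Omega>'\<close> are irrelevant.
\<close>

definition lip_bound :: "('d::finite site \<Rightarrow> 'd site pmf) \<Rightarrow> ('d config \<Rightarrow> real) \<Rightarrow> real \<Rightarrow> bool" where
  "lip_bound p f c \<longleftrightarrow>
     (\<forall>\<eta>\<in>Omega' p. \<forall>\<zeta>\<in>Omega' p. \<bar>f \<eta> - f \<zeta>\<bar> \<le> c * config_dist p \<eta> \<zeta>)"

definition Lip :: "('d::finite site \<Rightarrow> 'd site pmf) \<Rightarrow> ('d config \<Rightarrow> real) set" where
  "Lip p = {f. \<exists>c. lip_bound p f c}"

definition lip_const :: "('d::finite site \<Rightarrow> 'd site pmf) \<Rightarrow> ('d config \<Rightarrow> real) \<Rightarrow> real" where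
  "lip_const p f = (LEAST c. lip_bound p f c)"

text \<open>
  The nested update makes \<open>move x x \<eta> = \<eta>\<close> when \<open>\<eta> x > 0\<close>. If \<open>\<eta> x = 0\<close>, the value of
  \<open>move x z \<eta>\<close> is meaningless, but it only ever occurs with the factor \<open>g (\<eta> x) = g 0 = 0\<close>.
\<close>

definition move :: "'d::finite site \<Rightarrow> 'd site \<Rightarrow> 'd config \<Rightarrow> 'd config" where
  "move x z \<eta> = (let \<xi> = \<eta>(x := \<eta> x - 1) in \<xi>(z := \<xi> z + 1))"

definition gen :: "('d::finite site \<Rightarrow> 'd site pmf) \<Rightarrow> (nat \<Rightarrow> real) \<Rightarrow>
    ('d config \<Rightarrow> real) \<Rightarrow> 'd config \<Rightarrow> real" where
  "gen p g f \<eta> =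
     (\<Sum>\<^sub>\<infinity>(x, y)\<in>UNIV. pmf (p x) (x + y) * g (\<eta> x) * (f (move x (x + y) \<eta>) - f \<eta>))"

text \<open>
  A Markov chain on the countable set of finite configurations, given by its transition function
  \<open>K\<close>: \<open>K t \<eta>\<close> is the law of \<open>\<eta>\<^sub>t\<close> under \<open>P\<^sup>\<eta>\<close>. The last clause says that the
  rate matrix of the chain is that of the generator, i.e. \<open>q(\<eta>, \<xi>) = (L 1\<^bsub>{\<xi>}\<^esub>)(\<eta>)\<close>.
\<close>

definition chain_with_generator :: "('d::finite site \<Rightarrow> 'd site pmf) \<Rightarrow> (nat \<Rightarrow> real) \<Rightarrow>
    (real \<Rightarrow> 'd config \<Rightarrow> 'd config pmf) \<Rightarrow> bool" where
  "chain_with_generator p g K \<longleftrightarrow>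
     (\<forall>t\<ge>0. \<forall>\<eta>\<in>finite_configs. set_pmf (K t \<eta>) \<subseteq> finite_configs) \<and>
     (\<forall>\<eta>\<in>finite_configs. K 0 \<eta> = return_pmf \<eta>) \<and>
     (\<forall>s\<ge>0. \<forall>t\<ge>0. \<forall>\<eta>\<in>finite_configs. K (s + t) \<eta> = bind_pmf (K s \<eta>) (K t)) \<and>
     (\<forall>\<eta>\<in>finite_configs. \<forall>\<xi>\<in>finite_configs.
        ((\<lambda>t. (pmf (K t \<eta>) \<xi> - indicator {\<xi>} \<eta>) / t) \<longlongrightarrow> gen p g (indicator {\<xi>}) \<eta>) (at_right 0))"

definition config_space :: "('d::finite site \<Rightarrow> 'd site pmf) \<Rightarrow> 'd config measure" where
  "config_space p = restrict_space (Pi\<^sub>M UNIV (\<lambda>_. count_space UNIV)) (Omega' p)"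

locale zero_range =
  fixes p :: "'d::finite site \<Rightarrow> 'd site pmf"
    and g :: "nat \<Rightarrow> real"
    and a0 :: real
  assumes g_zero: "g 0 = 0"
    and g_pos: "k \<ge> 1 \<Longrightarrow> g k > 0"
    and g_lipschitz: "\<bar>g (k + 1) - g k\<bar> \<le> a0"
    and irreducible: "\<exists>n. pmf (nstep p n x) y > 0"
    and vanishing: "((\<lambda>x. pmf (p x) y) \<longlongrightarrow> 0) cofinite"

locale zero_range_semigroup = zero_range p g a0
  for p :: "'d::finite site \<Rightarrow> 'd site pmf" and g a0 +
  fixes K :: "real \<Rightarrow> 'd config \<Rightarrow> 'd config pmf"
    and P :: "real \<Rightarrow> ('d config \<Rightarrow> real) \<Rightarrow> 'd config \<Rightarrow> real"
    and Q :: "real \<Rightarrow> 'd config \<Rightarrow> 'd config measure"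
  assumes chain: "chain_with_generator p g K"
    and P_Lip: "\<lbrakk>t \<ge> 0; f \<in> Lip p\<rbrakk> \<Longrightarrow> P t f \<in> Lip p"
    and P_linear: "\<lbrakk>t \<ge> 0; f \<in> Lip p; h \<in> Lip p; \<eta> \<in> Omega' p\<rbrakk> \<Longrightarrow>
          P t (\<lambda>\<zeta>. a * f \<zeta> + b * h \<zeta>) \<eta> = a * P t f \<eta> + b * P t h \<eta>"
    and P_zero: "\<lbrakk>f \<in> Lip p; \<eta> \<in> Omega' p\<rbrakk> \<Longrightarrow> P 0 f \<eta> = f \<eta>"
    and P_add: "\<lbrakk>s \<ge> 0; t \<ge> 0; f \<in> Lip p; \<eta> \<in> Omega' p\<rbrakk> \<Longrightarrow> P (s + t) f \<eta> = P s (P t f) \<eta>"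
    and P_chain: "\<lbrakk>t \<ge> 0; f \<in> Lip p; \<eta> \<in> finite_configs\<rbrakk> \<Longrightarrow>
          P t f \<eta> = measure_pmf.expectation (K t \<eta>) f"
    and P_dist: "\<lbrakk>t \<ge> 0; f \<in> Lip p; \<eta> \<in> Omega' p; \<zeta> \<in> Omega' p\<rbrakk> \<Longrightarrow>
          \<bar>P t f \<eta> - P t f \<zeta>\<bar> \<le> lip_const p f * exp (4 * a0 * t) * config_dist p \<eta> \<zeta>"
    and P_integral: "\<lbrakk>t \<ge> 0; f \<in> Lip p; \<eta> \<in> Omega' p\<rbrakk> \<Longrightarrow>
          ((\<lambda>s. gen p g (P s f) \<eta>) has_integral (P t f \<eta> - f \<eta>)) {0..t}"
    and Q_prob: "\<lbrakk>t \<ge> 0; \<eta> \<in> Omega' p\<rbrakk> \<Longrightarrow> prob_space (Q t \<eta>)"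
    and Q_space: "\<lbrakk>t \<ge> 0; \<eta> \<in> Omega' p\<rbrakk> \<Longrightarrow> space (Q t \<eta>) = Omega' p"
    and Q_sets: "\<lbrakk>t \<ge> 0; \<eta> \<in> Omega' p\<rbrakk> \<Longrightarrow> sets (Q t \<eta>) = sets (config_space p)"
    and Q_norm: "\<lbrakk>t \<ge> 0; \<eta> \<in> Omega' p\<rbrakk> \<Longrightarrow> integrable (Q t \<eta>) (config_norm p)"
    and Q_repr: "\<lbrakk>t \<ge> 0; f \<in> Lip p; \<eta> \<in> Omega' p\<rbrakk> \<Longrightarrow> P t f \<eta> = (\<integral>\<zeta>. f \<zeta> \<partial>(Q t \<eta>))"

end

theory Submission
  imports Defs
begin

text \<open>
  The weight \<open>\<beta>\<close> satisfies \<open>\<Sum>\<^sub>y p(x,y) \<beta>(y) \<le> 2 \<beta>(x)\<close>, and one jump from \<open>x\<close> to \<open>z\<close> changes a function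
  with Lipschitz constant \<open>c\<close> by at most \<open>c (\<beta>(x) + \<beta>(z))\<close>. Together with \<open>g(k) \<le> a\<^sub>0 k\<close> this gives
  \<open>\<bar>Lf(\<eta>)\<bar> \<le> 3 a\<^sub>0 c \<parallel>\<eta>\<parallel>\<close>, and integrating in time gives the bound on \<open>P\<^sub>t f - f\<close>.
  The same summable domination makes \<open>s \<mapsto> L P\<^sub>s f(\<eta>)\<close> continuous, so the integral equation can be
  differentiated at \<open>0\<close>. For (iii), both \<open>P\<^sub>h (P\<^sub>t f)\<close> and \<open>P\<^sub>t (P\<^sub>h f)\<close> equal \<open>P\<^bsub>t+h\<^esub> f\<close>: the difference
  quotient of the first tends to \<open>L P\<^sub>t f\<close> by (ii), that of the second to \<open>P\<^sub>t L f\<close> by dominated convergence.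
  Functions in \<open>Lip p\<close> are measurable for the product \<open>\<sigma>\<close>-algebra because they are limits of functions of
  finitely many coordinates.
\<close>

lemma beta_summable: "summable (\<lambda>n. (1/2) ^ n * pmf (nstep p n x) 0)"
  by (rule summable_comparison_test'[OF summable_geometric[of "1/2::real"], of 0])
     (auto simp: pmf_le_1)

lemma beta_nonneg: "0 \<le> beta p x"
  unfolding beta_def by (intro suminf_nonneg beta_summable) auto

lemma beta_le_2: "beta p x \<le> 2"
proof -
  have "beta p x \<le> (\<Sum>n. (1/2::real) ^ n)"
    unfolding beta_def
    by (intro suminf_le beta_summable summable_geometric) (auto simp: pmf_le_1)
  then show ?thesis
    by (simp add: suminf_geometric)
qed

lemma beta_split: "beta p x = pmf (return_pmf x) 0 + (\<Sum>n. (1/2) ^ Suc n * pmf (nstep p (Suc n) x) 0)"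
  unfolding beta_def using suminf_split_head[OF beta_summable[of p x]] by simp

lemma beta_origin_pos: "0 < beta p 0"
proof -
  have "0 \<le> (\<Sum>n. (1/2::real) ^ Suc n * pmf (nstep p (Suc n) 0) 0)"
    using beta_summable[of p 0, folded summable_Suc_iff[of "\<lambda>n. (1/2) ^ n * pmf (nstep p n 0) 0"]]
    by (intro suminf_nonneg) auto
  then show ?thesis
    by (simp add: beta_split[of p 0])
qed

lemma expectation_beta_le: "measure_pmf.expectation (p x) (beta p) \<le> 2 * beta p x"
proof -
  have "measure_pmf.expectation (p x) (beta p)
      = (\<Sum>n. measure_pmf.expectation (p x) (\<lambda>y. (1/2) ^ n * pmf (nstep p n y) 0))"
    unfolding beta_def
  proof (rule integral_suminf)
    show int: "integrable (measure_pmf (p x)) (\<lambda>y. (1/2) ^ n * pmf (nstep p n y) 0)" for n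
      by (rule measure_pmf.integrable_const_bound[where B = 1])
         (auto simp: pmf_le_1 power_le_one mult_le_one)
    show "AE y in p x. summable (\<lambda>n. norm ((1/2) ^ n * pmf (nstep p n y) 0))"
      by (auto simp: abs_mult beta_summable)
    show "summable (\<lambda>n. measure_pmf.expectation (p x) (\<lambda>y. norm ((1/2) ^ n * pmf (nstep p n y) 0)))"
    proof (rule summable_comparison_test'[OF summable_geometric[of "1/2::real"], of 0])
      fix n
      have "measure_pmf.expectation (p x) (\<lambda>y. norm ((1/2) ^ n * pmf (nstep p n y) 0)) \<le> (1/2) ^ n"
        using int[of n]
        by (intro measure_pmf.integral_le_const integrable_norm) (auto simp: pmf_le_1 abs_mult)
      then show "norm (measure_pmf.expectation (p x) (\<lambda>y. norm ((1/2) ^ n * pmf (nstep p n y) 0))) \<le> (1/2) ^ n"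
        by (simp add: integral_nonneg_AE)
    qed simp
  qed
  also have "\<dots> = (\<Sum>n. 2 * ((1/2) ^ Suc n * pmf (nstep p (Suc n) x) 0))"
    by (simp add: pmf_bind)
  also have "\<dots> = 2 * (\<Sum>n. (1/2) ^ Suc n * pmf (nstep p (Suc n) x) 0)"
    using beta_summable[of p x, folded summable_Suc_iff[of "\<lambda>n. (1/2) ^ n * pmf (nstep p n x) 0"]]
    by (rule suminf_mult)
  also have "\<dots> \<le> 2 * beta p x"
    by (simp add: beta_split[of p x])
  finally show ?thesis .
qed

lemma has_sum_pmf_expectation:
  fixes h :: "'a \<Rightarrow> real"
  assumes "\<And>y. \<bar>h y\<bar> \<le> C"
  shows "((\<lambda>y. pmf q y * h y) has_sum measure_pmf.expectation q h) UNIV"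
proof -
  have "Infinite_Set_Sum.abs_summable_on (\<lambda>y. C * pmf q y) UNIV"
    by (intro abs_summable_on_cmult_right pmf_abs_summable)
  then have "Infinite_Set_Sum.abs_summable_on (\<lambda>y. pmf q y * h y) UNIV"
    by (rule Infinite_Set_Sum.abs_summable_on_comparison_test')
       (use assms in \<open>auto simp: abs_mult mult.commute[of C] intro!: mult_left_mono\<close>)
  note abs = this
  have "(\<lambda>y. pmf q y * h y) summable_on UNIV"
    by (rule abs_summable_summable) (simp only: abs abs_summable_equivalent)
  with abs show ?thesis
    by (simp add: has_sum_iff pmf_expectation_eq_infsetsum infsetsum_infsum)
qed

lemma has_sum_jump:
  fixes h :: "'d::finite site \<Rightarrow> real"
  assumes "\<And>y. \<bar>h y\<bar> \<le> C"
  shows "((\<lambda>y. pmf q (x + y) * h (x + y)) has_sum measure_pmf.expectation q h) UNIV"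
  using has_sum_pmf_expectation[of h C q, OF assms]
    has_sum_reindex[of "(+) x" UNIV "\<lambda>y. pmf q y * h y" "measure_pmf.expectation q h"]
  by (simp add: o_def)

definition jump_weight ::
  "('d::finite site \<Rightarrow> 'd site pmf) \<Rightarrow> (nat \<Rightarrow> real) \<Rightarrow> 'd config \<Rightarrow> 'd site \<times> 'd site \<Rightarrow> real" where
  "jump_weight p g \<eta> = (\<lambda>(x, y). pmf (p x) (x + y) * g (\<eta> x) * (beta p x + beta p (x + y)))"

lemma has_sum_jump_weight:
  "((\<lambda>y. jump_weight p g \<eta> (x, y)) has_sum
     g (\<eta> x) * (beta p x + measure_pmf.expectation (p x) (beta p))) UNIV"
proof -
  have "integrable (measure_pmf (p x)) (beta p)"
    by (rule measure_pmf.integrable_const_bound[where B = 2]) (auto simp: beta_nonneg beta_le_2)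
  moreover have "\<bar>beta p x + beta p y\<bar> \<le> 4" for y
    using beta_nonneg[of p x] beta_nonneg[of p y] beta_le_2[of p x] beta_le_2[of p y] by linarith
  ultimately have "((\<lambda>y. pmf (p x) (x + y) * (beta p x + beta p (x + y))) has_sum
      beta p x + measure_pmf.expectation (p x) (beta p)) UNIV"
    using has_sum_jump[of "\<lambda>y. beta p x + beta p y" 4 "p x" x] by simp
  from has_sum_cmult_right[OF this, of "g (\<eta> x)"] show ?thesis
    by (simp add: jump_weight_def mult_ac)
qed

lemma Omega'_move: "\<eta> \<in> Omega' p \<Longrightarrow> move x z \<eta> \<in> Omega' p"
proof -
  assume \<eta>: "\<eta> \<in> Omega' p"
  have "(\<lambda>y. if y = z then beta p z else 0) summable_on UNIV"
    by (rule has_sum_imp_summable[OF has_sum_finite_neutralI[of "{z}"]]) auto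
  then have "(\<lambda>y. real (\<eta> y) * beta p y + (if y = z then beta p z else 0)) summable_on UNIV"
    using \<eta> unfolding Omega'_def by (intro summable_on_add) auto
  then show ?thesis
    unfolding Omega'_def mem_Collect_eq
  proof (rule summable_on_comparison_test)
    fix y
    have "real (move x z \<eta> y) \<le> real (\<eta> y) + (if y = z then 1 else 0)"
      by (auto simp: move_def Let_def)
    then have "real (move x z \<eta> y) * beta p y \<le> (real (\<eta> y) + (if y = z then 1 else 0)) * beta p y"
      by (rule mult_right_mono) (rule beta_nonneg)
    then show "real (move x z \<eta> y) * beta p y \<le> real (\<eta> y) * beta p y + (if y = z then beta p z else 0)"
      by (simp add: algebra_simps split: if_splits)
  qed (simp add: beta_nonneg)
qed

lemma config_dist_move_le:
  assumes "0 < \<eta> x"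
  shows "config_dist p (move x z \<eta>) \<eta> \<le> beta p x + beta p z"
proof (cases "x = z")
  case True
  then have "move x z \<eta> = \<eta>" using assms by (auto simp: move_def Let_def)
  then show ?thesis by (simp add: config_dist_def beta_nonneg)
next
  case False
  have "((\<lambda>y. \<bar>real (move x z \<eta> y) - real (\<eta> y)\<bar> * beta p y) has_sum (beta p x + beta p z)) UNIV"
    by (rule has_sum_finite_neutralI[of "{x, z}"]) (use False assms in \<open>auto simp: move_def Let_def\<close>)
  then show ?thesis by (simp add: config_dist_def infsumI)
qed

lemma zero_in_Omega': "(\<lambda>_. 0) \<in> Omega' p"
  by (simp add: Omega'_def)

lemma config_dist_zero: "config_dist p \<eta> (\<lambda>_. 0) = config_norm p \<eta>"
  by (simp add: config_dist_def config_norm_def)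

lemma config_norm_nonneg: "0 \<le> config_norm p \<eta>"
  unfolding config_norm_def by (intro infsum_nonneg) (simp add: beta_nonneg)

lemma lip_bound_nonneg:
  assumes "lip_bound p f c"
  shows "0 \<le> c"
proof -
  define \<delta> :: "'a config" where "\<delta> = (\<lambda>x. if x = 0 then 1 else 0)"
  have sum: "((\<lambda>x. real (\<delta> x) * beta p x) has_sum beta p 0) UNIV"
    by (rule has_sum_finite_neutralI[of "{0}"]) (auto simp: \<delta>_def)
  then have "\<delta> \<in> Omega' p" "config_norm p \<delta> = beta p 0"
    using has_sum_imp_summable[OF sum] by (simp_all add: Omega'_def config_norm_def infsumI)
  then have "\<bar>f \<delta> - f (\<lambda>_. 0)\<bar> \<le> c * beta p 0"
    using assms[unfolded lip_bound_def, rule_format, of \<delta> "\<lambda>_. 0"] zero_in_Omega'[of p]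
    by (simp add: config_dist_zero)
  then have "0 \<le> c * beta p 0" by linarith
  then show ?thesis using beta_origin_pos[of p] by (simp add: zero_le_mult_iff)
qed

lemma lip_bound_lip_const:
  assumes "f \<in> Lip p"
  shows "lip_bound p f (lip_const p f)"
proof -
  define S where "S = {c. lip_bound p f c}"
  have S: "S = (\<Inter>\<eta>\<in>Omega' p. \<Inter>\<zeta>\<in>Omega' p. {c. \<bar>f \<eta> - f \<zeta>\<bar> \<le> c * config_dist p \<eta> \<zeta>})"
    by (auto simp: S_def lip_bound_def)
  have "closed S"
    unfolding S by (intro closed_INT ballI closed_Collect_le continuous_intros)
  moreover have ne: "S \<noteq> {}" using assms by (auto simp: S_def Lip_def)
  moreover have bdd: "bdd_below S" by (rule bdd_belowI[of _ 0]) (simp add: S_def lip_bound_nonneg)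
  ultimately have "Inf S \<in> S" by (intro closed_contains_Inf)
  moreover have "(LEAST c. lip_bound p f c) = Inf S"
  proof (rule Least_equality)
    show "lip_bound p f (Inf S)" using \<open>Inf S \<in> S\<close> unfolding S_def by (rule CollectD)
    show "Inf S \<le> c" if "lip_bound p f c" for c
      using that bdd by (intro cInf_lower) (simp_all add: S_def)
  qed
  ultimately show ?thesis
    by (simp add: lip_const_def S_def)
qed

lemma lip_const_nonneg: "f \<in> Lip p \<Longrightarrow> 0 \<le> lip_const p f"
  by (rule lip_bound_nonneg[OF lip_bound_lip_const])

context zero_range
begin

lemma g_nonneg: "0 \<le> g k"
  using g_pos[of k] g_zero by (cases "k \<ge> 1") (auto simp: not_less_eq_eq)

lemma a0_pos: "0 < a0"
  using g_lipschitz[of 0] g_pos[of 1] g_zero by simp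

lemma g_le: "g k \<le> a0 * real k"
proof (induction k)
  case (Suc k)
  then show ?case
    using g_lipschitz[of k] by (simp add: algebra_simps)
qed (simp add: g_zero)

lemma jump_weight_nonneg: "0 \<le> jump_weight p g \<eta> z"
  by (auto simp: jump_weight_def split_beta g_nonneg beta_nonneg)

lemma jump_weight_row_le:
  "g (\<eta> x) * (beta p x + measure_pmf.expectation (p x) (beta p)) \<le> 3 * a0 * (real (\<eta> x) * beta p x)"
proof -
  have "g (\<eta> x) * (beta p x + measure_pmf.expectation (p x) (beta p)) \<le> (a0 * real (\<eta> x)) * (3 * beta p x)"
    using expectation_beta_le[of p x] g_nonneg[of "\<eta> x"] g_le[of "\<eta> x"]
    by (intro mult_mono) (auto simp: beta_nonneg integral_nonneg_AE)
  then show ?thesis by (simp add: mult_ac)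
qed

lemma
  assumes "\<eta> \<in> Omega' p"
  shows jump_weight_summable: "jump_weight p g \<eta> summable_on UNIV"
    and infsum_jump_weight_le: "infsum (jump_weight p g \<eta>) UNIV \<le> 3 * a0 * config_norm p \<eta>"
proof -
  define r where "r = (\<lambda>x. g (\<eta> x) * (beta p x + measure_pmf.expectation (p x) (beta p)))"
  have norm: "((\<lambda>x. 3 * a0 * (real (\<eta> x) * beta p x)) has_sum 3 * a0 * config_norm p \<eta>) UNIV"
    using assms unfolding config_norm_def Omega'_def by (intro has_sum_cmult_right) simp
  have rsum: "r summable_on UNIV"
    by (rule summable_on_comparison_test[OF has_sum_imp_summable[OF norm]])
       (auto simp: r_def jump_weight_row_le g_nonneg beta_nonneg integral_nonneg_AE)
  have summable: "jump_weight p g \<eta> summable_on (SIGMA x:UNIV. UNIV)"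
    by (rule summable_on_SigmaI[where g = r]) (auto simp: r_def has_sum_jump_weight jump_weight_nonneg rsum[unfolded r_def])
  then show "jump_weight p g \<eta> summable_on UNIV" by simp
  have "(jump_weight p g \<eta> has_sum infsum r UNIV) (SIGMA x:UNIV. UNIV)"
    by (rule has_sum_SigmaI[where g = r]) (auto simp: r_def has_sum_jump_weight summable[simplified] rsum[unfolded r_def])
  moreover have "infsum r UNIV \<le> 3 * a0 * config_norm p \<eta>"
    by (rule has_sum_mono[OF has_sum_infsum[OF rsum] norm]) (simp add: r_def jump_weight_row_le)
  ultimately show "infsum (jump_weight p g \<eta>) UNIV \<le> 3 * a0 * config_norm p \<eta>"
    by (simp add: infsumI)
qed

lemma gen_summand_le:
  assumes "lip_bound p f c" "\<eta> \<in> Omega' p"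
  shows "\<bar>pmf (p x) (x + y) * g (\<eta> x) * (f (move x (x + y) \<eta>) - f \<eta>)\<bar> \<le> c * jump_weight p g \<eta> (x, y)"
proof (cases "\<eta> x = 0")
  case False
  then have "\<bar>f (move x (x + y) \<eta>) - f \<eta>\<bar> \<le> c * config_dist p (move x (x + y) \<eta>) \<eta>"
    using assms(1)[unfolded lip_bound_def] assms(2) Omega'_move[OF assms(2)] by blast
  also have "\<dots> \<le> c * (beta p x + beta p (x + y))"
    using False lip_bound_nonneg[OF assms(1)] by (intro mult_left_mono config_dist_move_le) auto
  finally have "pmf (p x) (x + y) * g (\<eta> x) * \<bar>f (move x (x + y) \<eta>) - f \<eta>\<bar> 
      \<le> pmf (p x) (x + y) * g (\<eta> x) * (c * (beta p x + beta p (x + y)))"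
    by (rule mult_left_mono) (simp add: g_nonneg)
  then show ?thesis
    by (simp add: jump_weight_def abs_mult g_nonneg mult_ac)
qed (simp add: g_zero jump_weight_def)

lemma abs_gen_le:
  assumes "lip_bound p f c" "\<eta> \<in> Omega' p"
  shows "\<bar>gen p g f \<eta>\<bar> \<le> 3 * a0 * c * config_norm p \<eta>"
proof -
  note summand = gen_summand_le[OF assms]
  have weight: "((\<lambda>z. c * jump_weight p g \<eta> z) has_sum c * infsum (jump_weight p g \<eta>) UNIV) UNIV"
    by (intro has_sum_cmult_right has_sum_infsum jump_weight_summable assms)
  have "norm (gen p g f \<eta>) \<le> c * infsum (jump_weight p g \<eta>) UNIV"
  proof (rule norm_infsum_le[OF _ weight])
    show "((\<lambda>(x, y). pmf (p x) (x + y) * g (\<eta> x) * (f (move x (x + y) \<eta>) - f \<eta>)) has_sum gen p g f \<eta>) UNIV"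
      unfolding gen_def
    proof (rule has_sum_infsum, rule abs_summable_summable)
      show "(\<lambda>z. norm (case z of (x, y) \<Rightarrow> pmf (p x) (x + y) * g (\<eta> x) * (f (move x (x + y) \<eta>) - f \<eta>)))
          summable_on UNIV"
        by (rule Infinite_Sum.abs_summable_on_comparison_test'[OF has_sum_imp_summable[OF weight]]) (simp add: summand split: prod.split)
    qed
  qed (simp add: summand split: prod.split)
  also have "\<dots> \<le> c * (3 * a0 * config_norm p \<eta>)"
    by (intro mult_left_mono infsum_jump_weight_le assms lip_bound_nonneg[OF assms(1)])
  finally show ?thesis by (simp add: mult_ac)
qed

end

definition truncate :: "nat \<Rightarrow> 'd::finite config \<Rightarrow> 'd config" where
  "truncate n \<eta> = (\<lambda>x. if to_nat x < n then \<eta> x else 0)"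

lemma finite_to_nat_less: "finite {x::'a::countable. to_nat x < n}"
  using finite_vimageI[OF finite_lessThan inj_to_nat, of n] by (simp add: vimage_def)

lemma Omega'_truncate:
  assumes "\<eta> \<in> Omega' p"
  shows "truncate n \<eta> \<in> Omega' p"
  using assms unfolding Omega'_def mem_Collect_eq
  by (rule summable_on_comparison_test) (auto simp: truncate_def beta_nonneg)

lemma config_dist_truncate_tendsto:
  fixes \<eta> :: "'d::finite config"
  assumes "\<eta> \<in> Omega' p"
  shows "(\<lambda>n. config_dist p (truncate n \<eta>) \<eta>) \<longlonglongrightarrow> 0"
proof -
  define A :: "nat \<Rightarrow> 'd site set" where "A n = {x. to_nat x < n}" for n
  define m where "m = (\<lambda>x. real (\<eta> x) * beta p x)"
  have fin: "finite (A n)" for n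
    unfolding A_def by (rule finite_to_nat_less)
  have m: "(m has_sum config_norm p \<eta>) UNIV"
    using assms unfolding m_def config_norm_def Omega'_def by simp
  have "config_dist p (truncate n \<eta>) \<eta> = config_norm p \<eta> - sum m (A n)" for n
  proof -
    have "((\<lambda>x. if x \<in> A n then m x else 0) has_sum sum m (A n)) UNIV"
      by (rule has_sum_finite_neutralI[OF fin]) auto
    from has_sum_add[OF m has_sum_cmult_right[OF this, of "-1"]]
    have "((\<lambda>x. m x - (if x \<in> A n then m x else 0)) has_sum (config_norm p \<eta> - sum m (A n))) UNIV"
      by simp
    moreover have "m x - (if x \<in> A n then m x else 0) = \<bar>real (truncate n \<eta> x) - real (\<eta> x)\<bar> * beta p x" for x
      by (simp add: A_def m_def truncate_def)
    ultimately show ?thesis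
      unfolding config_dist_def by (simp add: infsumI)
  qed
  moreover have "filterlim A (finite_subsets_at_top UNIV) sequentially"
    unfolding filterlim_finite_subsets_at_top
  proof (intro allI impI)
    fix X :: "'d site set"
    assume "finite X \<and> X \<subseteq> UNIV"
    then have "\<forall>\<^sub>F n in sequentially. \<forall>x\<in>X. to_nat x < n"
      by (intro eventually_ball_finite ballI eventually_gt_at_top) auto
    then show "\<forall>\<^sub>F n in sequentially. finite (A n) \<and> X \<subseteq> A n \<and> A n \<subseteq> UNIV"
      by eventually_elim (auto simp: A_def finite_to_nat_less)
  qed
  then have "(\<lambda>n. sum m (A n)) \<longlonglongrightarrow> config_norm p \<eta>"
    using m unfolding has_sum_def by (rule filterlim_compose[rotated])
  then have "(\<lambda>n. config_norm p \<eta> - sum m (A n)) \<longlonglongrightarrow> config_norm p \<eta> - config_norm p \<eta>"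
    by (intro tendsto_intros)
  ultimately show ?thesis by simp
qed

lemma Lip_truncate_tendsto:
  assumes "f \<in> Lip p" "\<eta> \<in> Omega' p"
  shows "(\<lambda>n. f (truncate n \<eta>)) \<longlonglongrightarrow> f \<eta>"
proof -
  obtain c where c: "lip_bound p f c" using assms(1) by (auto simp: Lip_def)
  have lim: "(\<lambda>n. c * config_dist p (truncate n \<eta>) \<eta>) \<longlonglongrightarrow> c * 0"
    by (intro tendsto_intros config_dist_truncate_tendsto assms)
  have "(\<lambda>n. f (truncate n \<eta>) - f \<eta>) \<longlonglongrightarrow> 0"
    by (rule Lim_null_comparison[OF always_eventually lim[simplified]])
       (use c[unfolded lip_bound_def, rule_format, OF Omega'_truncate[OF assms(2)] assms(2)] in simp)
  then show ?thesis by (simp add: LIM_zero_iff)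
qed

lemma space_config_space: "space (config_space p) = Omega' p"
  by (simp add: config_space_def space_restrict_space space_PiM)

lemma borel_measurable_truncate:
  fixes f :: "'d::finite config \<Rightarrow> real"
  shows "(\<lambda>\<eta>. f (truncate n \<eta>)) \<in> borel_measurable (config_space p)"
proof -
  define A :: "'d site set" where "A = {x. to_nat x < n}"
  have "(\<lambda>\<eta>::'d config. restrict \<eta> A) \<in> measurable (Pi\<^sub>M UNIV (\<lambda>_. count_space UNIV)) (Pi\<^sub>M A (\<lambda>_. count_space UNIV))"
    by (rule measurable_restrict_subset) simp
  moreover have "Pi\<^sub>M A (\<lambda>_. count_space UNIV) = count_space (Pi\<^sub>E A (\<lambda>_. UNIV :: nat set))"
    by (rule count_space_PiM_finite) (simp_all add: A_def finite_to_nat_less)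
  ultimately have "(\<lambda>\<eta>::'d config. restrict \<eta> A) \<in>
      measurable (Pi\<^sub>M UNIV (\<lambda>_. count_space UNIV)) (count_space (Pi\<^sub>E A (\<lambda>_. UNIV)))"
    by simp
  moreover have "(\<lambda>\<xi>. f (truncate n \<xi>)) \<in> borel_measurable (count_space (Pi\<^sub>E A (\<lambda>_. UNIV)))"
    by simp
  ultimately have "(\<lambda>\<eta>. f (truncate n (restrict \<eta> A))) \<in> borel_measurable (Pi\<^sub>M UNIV (\<lambda>_. count_space UNIV))"
    by (rule measurable_compose)
  moreover have "truncate n (restrict \<eta> A) = truncate n \<eta>" for \<eta>
    by (auto simp: truncate_def A_def)
  ultimately show ?thesis
    unfolding config_space_def by (intro measurable_restrict_space1) simp
qed

lemma Lip_borel_measurable: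
  assumes "f \<in> Lip p"
  shows "f \<in> borel_measurable (config_space p)"
  by (rule borel_measurable_LIMSEQ_real[where u = "\<lambda>n \<eta>. f (truncate n \<eta>)"])
     (simp_all add: space_config_space Lip_truncate_tendsto[OF assms] borel_measurable_truncate)

context zero_range_semigroup
begin

lemma lip_bound_P:
  "\<lbrakk>t \<ge> 0; f \<in> Lip p\<rbrakk> \<Longrightarrow> lip_bound p (P t f) (lip_const p f * exp (4 * a0 * t))"
  by (simp add: lip_bound_def P_dist)

lemma abs_gen_P_le:
  assumes "t \<ge> 0" "f \<in> Lip p" "\<eta> \<in> Omega' p"
  shows "\<bar>gen p g (P t f) \<eta>\<bar> \<le> 3 * a0 * lip_const p f * exp (4 * a0 * t) * config_norm p \<eta>"
  using abs_gen_le[OF lip_bound_P[OF assms(1,2)] assms(3)] by (simp add: mult_ac)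

lemma abs_P_diff_le:
  assumes "t \<ge> 0" "f \<in> Lip p" "\<eta> \<in> Omega' p"
  shows "\<bar>P t f \<eta> - f \<eta>\<bar> \<le>
    3 * a0 * (inverse (4 * a0) * lip_const p f * config_norm p \<eta> * (exp (4 * a0 * t) - 1))"
    (is "_ \<le> ?B")
proof -
  define C where "C = 3 * a0 * lip_const p f * config_norm p \<eta>"
  have "((\<lambda>s. C * exp (4 * a0 * s)) has_integral
      (C * exp (4 * a0 * t) / (4 * a0) - C * exp (4 * a0 * 0) / (4 * a0))) {0..t}"
    using a0_pos assms(1)
    by (intro fundamental_theorem_of_calculus)
       (auto intro!: derivative_eq_intros simp: has_real_derivative_iff_has_vector_derivative[symmetric])
  moreover have "C * exp (4 * a0 * t) / (4 * a0) - C * exp (4 * a0 * 0) / (4 * a0) = ?B"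
    using a0_pos by (simp add: C_def field_simps)
  ultimately have upper: "((\<lambda>s. C * exp (4 * a0 * s)) has_integral ?B) {0..t}" by (simp only:)
  have "\<bar>gen p g (P s f) \<eta>\<bar> \<le> C * exp (4 * a0 * s)" if "s \<in> {0..t}" for s
    using abs_gen_P_le[of s f \<eta>] that assms by (simp add: C_def mult_ac)
  then have bound: "gen p g (P s f) \<eta> \<le> C * exp (4 * a0 * s)" "- gen p g (P s f) \<eta> \<le> C * exp (4 * a0 * s)" if "s \<in> {0..t}" for s
    using that by (fastforce simp: abs_le_iff)+
  note int = P_integral[OF assms]
  have "P t f \<eta> - f \<eta> \<le> ?B"
    by (rule has_integral_le[OF int upper]) (simp only: bound)
  moreover have "- (P t f \<eta> - f \<eta>) \<le> ?B"
    by (rule has_integral_le[OF has_integral_neg[OF int] upper]) (simp only: bound)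
  ultimately show ?thesis by linarith
qed

lemma continuous_on_P:
  assumes "f \<in> Lip p" "\<eta> \<in> Omega' p"
  shows "continuous_on {0..T} (\<lambda>t. P t f \<eta>)"
proof (cases "0 \<le> T")
  case True
  have "continuous_on {0..T} (\<lambda>t. f \<eta> + integral {0..t} (\<lambda>s. gen p g (P s f) \<eta>))"
    using P_integral[OF True assms]
    by (intro continuous_intros indefinite_integral_continuous_1) (rule has_integral_integrable)
  then show ?thesis
    by (rule continuous_on_cong[THEN iffD1, rotated 2])
       (auto simp: integral_unique[OF P_integral] assms)
qed simp

text \<open>Dominated convergence over the jumps \<open>(x, y)\<close>, in the form of the Weierstrass M-test.\<close>

lemma continuous_on_gen_P:
  assumes "f \<in> Lip p" "\<eta> \<in> Omega' p"
  shows "continuous_on {0..T} (\<lambda>t. gen p g (P t f) \<eta>)"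
proof -
  define u where "u = (\<lambda>(x, y) t. pmf (p x) (x + y) * g (\<eta> x) * (P t f (move x (x + y) \<eta>) - P t f \<eta>))"
  define M where "M = (\<lambda>z. lip_const p f * exp (4 * a0 * T) * jump_weight p g \<eta> z)"
  have "norm (u z t) \<le> M z" if t: "t \<in> {0..T}" for z t
  proof -
    obtain x y where z: "z = (x, y)" by (cases z)
    have "norm (u z t) \<le> lip_const p f * exp (4 * a0 * t) * jump_weight p g \<eta> z"
      using gen_summand_le[OF lip_bound_P[of t f] assms(2), of x y] t assms by (simp add: u_def z)
    also have "\<dots> \<le> M z"
      using t a0_pos assms(1) unfolding M_def
      by (intro mult_right_mono mult_left_mono jump_weight_nonneg lip_const_nonneg) auto
    finally show ?thesis .
  qed
  moreover have "M summable_on UNIV"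
    unfolding M_def by (intro summable_on_cmult_right jump_weight_summable assms)
  ultimately have "uniform_limit {0..T} (\<lambda>F t. \<Sum>z\<in>F. u z t) (\<lambda>t. \<Sum>\<^sub>\<infinity>z. u z t) (finite_subsets_at_top UNIV)"
    by (intro Weierstrass_m_test_general) auto
  moreover have "continuous_on {0..T} (u z)" for z
    by (cases z) (auto simp: u_def intro!: continuous_intros continuous_on_P assms Omega'_move)
  then have "\<forall>\<^sub>F F in finite_subsets_at_top UNIV. continuous_on {0..T} (\<lambda>t. \<Sum>z\<in>F. u z t)"
    by (intro always_eventually allI continuous_on_sum)
  ultimately have "continuous_on {0..T} (\<lambda>t. \<Sum>\<^sub>\<infinity>z. u z t)"
    by (intro uniform_limit_theorem) auto
  moreover have "gen p g (P t f) \<eta> = (\<Sum>\<^sub>\<infinity>z. u z t)" for t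
    unfolding gen_def u_def by (rule infsum_cong) auto
  ultimately show ?thesis by simp
qed

lemma gen_P_zero:
  assumes "f \<in> Lip p" "\<eta> \<in> Omega' p"
  shows "gen p g (P 0 f) \<eta> = gen p g f \<eta>"
  unfolding gen_def using assms by (simp add: P_zero Omega'_move)

lemma P_derivative:
  assumes "f \<in> Lip p" "\<eta> \<in> Omega' p"
  shows "((\<lambda>h. (P h f \<eta> - f \<eta>) / h) \<longlongrightarrow> gen p g f \<eta>) (at_right 0)"
proof -
  have "((\<lambda>u. integral {0..u} (\<lambda>s. gen p g (P s f) \<eta>)) has_real_derivative gen p g (P 0 f) \<eta>) (at 0 within {0..1})"
    by (intro integral_has_real_derivative continuous_on_gen_P assms) simp
  then have "((\<lambda>h. integral {0..h} (\<lambda>s. gen p g (P s f) \<eta>) / h) \<longlongrightarrow> gen p g f \<eta>) (at_right 0)"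
    by (simp add: has_field_derivative_iff at_within_Icc_at_right gen_P_zero assms)
  then show ?thesis
  proof (rule Lim_transform_eventually)
    show "\<forall>\<^sub>F h in at_right 0. integral {0..h} (\<lambda>s. gen p g (P s f) \<eta>) / h = (P h f \<eta> - f \<eta>) / h"
      using eventually_at_right_less[of 0]
      by eventually_elim (simp add: integral_unique[OF P_integral] assms)
  qed
qed

lemma Lip_integrable:
  assumes "f \<in> Lip p" "t \<ge> 0" "\<eta> \<in> Omega' p"
  shows "integrable (Q t \<eta>) f"
proof -
  interpret prob_space "Q t \<eta>" using assms by (intro Q_prob)
  have meas: "f \<in> borel_measurable (Q t \<eta>)"
    using Lip_borel_measurable[OF assms(1)] measurable_cong_sets[OF Q_sets refl] assms by blast
  show ?thesis
  proof (rule Bochner_Integration.integrable_bound[OF _ meas])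
    show "integrable (Q t \<eta>) (\<lambda>\<zeta>. \<bar>f (\<lambda>_. 0)\<bar> + lip_const p f * config_norm p \<zeta>)"
      using assms by (intro Bochner_Integration.integrable_add integrable_mult_right Q_norm) auto
    have "\<bar>f \<zeta>\<bar> \<le> \<bar>f (\<lambda>_. 0)\<bar> + lip_const p f * config_norm p \<zeta>" if "\<zeta> \<in> Omega' p" for \<zeta>
      using lip_bound_lip_const[OF assms(1), unfolded lip_bound_def, rule_format, OF that zero_in_Omega']
      by (simp add: config_dist_zero)
    then show "AE \<zeta> in Q t \<eta>. norm (f \<zeta>) \<le> norm (\<bar>f (\<lambda>_. 0)\<bar> + lip_const p f * config_norm p \<zeta>)"
      using assms lip_const_nonneg[OF assms(1)]
      by (intro AE_I2) (simp add: Q_space config_norm_nonneg)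
  qed
qed

lemma abs_difference_quotient_le:
  assumes "0 < h" "h \<le> 1" "f \<in> Lip p" "\<eta> \<in> Omega' p"
  shows "\<bar>(P h f \<eta> - f \<eta>) / h\<bar> \<le> 3 * a0 * lip_const p f * exp (4 * a0) * config_norm p \<eta>"
proof -
  define u where "u = 4 * a0 * h"
  have u: "0 < u" "u \<le> 4 * a0" using assms a0_pos by (auto simp: u_def)
  have "(1 - u) * exp u \<le> exp (- u) * exp u"
    using exp_ge_add_one_self[of "- u"] by (intro mult_right_mono) auto
  then have "exp u - 1 \<le> u * exp u"
    by (simp add: algebra_simps flip: exp_add)
  also have "\<dots> \<le> u * exp (4 * a0)" using u by simp
  finally have exp: "exp u - 1 \<le> u * exp (4 * a0)" .
  have "\<bar>P h f \<eta> - f \<eta>\<bar> \<le> 3 * a0 * (inverse (4 * a0) * lip_const p f * config_norm p \<eta> * (exp u - 1))"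
    using abs_P_diff_le[of h f \<eta>] assms by (simp add: u_def)
  also have "\<dots> \<le> 3 * a0 * (inverse (4 * a0) * lip_const p f * config_norm p \<eta> * (u * exp (4 * a0)))"
    using a0_pos assms by (intro mult_left_mono exp mult_nonneg_nonneg lip_const_nonneg config_norm_nonneg) auto
  also have "\<dots> = 3 * a0 * lip_const p f * exp (4 * a0) * config_norm p \<eta> * h"
    using a0_pos by (simp add: u_def field_simps)
  finally show ?thesis
    using assms(1) by (simp add: abs_divide pos_divide_le_eq)
qed

lemma gen_P_commute:
  assumes "f \<in> Lip p" "t \<ge> 0" "\<eta> \<in> Omega' p"
  shows "integrable (Q t \<eta>) (gen p g f) \<and> gen p g (P t f) \<eta> = (\<integral>\<zeta>. gen p g f \<zeta> \<partial>(Q t \<eta>))"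
proof -
  define h where "h n = 1 / real (Suc n)" for n
  define D where "D n \<zeta> = (P (h n) f \<zeta> - f \<zeta>) / h n" for n \<zeta>
  have h: "0 < h n" "h n \<le> 1" for n by (auto simp: h_def)
  have h_lim: "filterlim h (at_right 0) sequentially"
    unfolding h_def filterlim_at using LIMSEQ_inverse_real_of_nat by (auto simp: inverse_eq_divide)
  have space: "space (Q t \<eta>) = Omega' p" using assms by (intro Q_space)
  have int_f: "integrable (Q t \<eta>) f" by (intro Lip_integrable assms)
  have int_P: "integrable (Q t \<eta>) (P (h n) f)" for n
    using h[of n] by (intro Lip_integrable P_Lip assms) auto
  have D_lim: "(\<lambda>n. D n \<zeta>) \<longlonglongrightarrow> gen p g f \<zeta>" if "\<zeta> \<in> Omega' p" for \<zeta>
    unfolding D_def using filterlim_compose[OF P_derivative[OF assms(1) that] h_lim] .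
  have D_meas: "D n \<in> borel_measurable (Q t \<eta>)" for n
    using int_f int_P[of n] unfolding D_def by (intro borel_measurable_divide borel_measurable_diff) auto
  have gen_meas: "gen p g f \<in> borel_measurable (Q t \<eta>)"
    by (rule borel_measurable_LIMSEQ_real[where u = D]) (simp_all add: space D_lim D_meas)
  have weight: "integrable (Q t \<eta>) (\<lambda>\<zeta>. 3 * a0 * lip_const p f * exp (4 * a0) * config_norm p \<zeta>)"
    using assms by (intro integrable_mult_right Q_norm)
  have lim_ae: "AE \<zeta> in Q t \<eta>. (\<lambda>n. D n \<zeta>) \<longlonglongrightarrow> gen p g f \<zeta>"
    by (rule AE_I2) (simp add: space D_lim)
  have bound_ae: "AE \<zeta> in Q t \<eta>. norm (D n \<zeta>) \<le> 3 * a0 * lip_const p f * exp (4 * a0) * config_norm p \<zeta>" for n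
    using abs_difference_quotient_le[OF h assms(1), of _ n] by (intro AE_I2) (simp add: space D_def)
  note dominated = gen_meas D_meas weight lim_ae bound_ae
  have "(\<integral>\<zeta>. D n \<zeta> \<partial>(Q t \<eta>)) = (P (h n) (P t f) \<eta> - P t f \<eta>) / h n" for n
  proof -
    have "(\<integral>\<zeta>. D n \<zeta> \<partial>(Q t \<eta>)) = (P t (P (h n) f) \<eta> - P t f \<eta>) / h n"
      unfolding D_def using int_f int_P[of n] h[of n] assms by (simp add: Q_repr P_Lip)
    also have "P t (P (h n) f) \<eta> = P (h n) (P t f) \<eta>"
      using h[of n] assms by (simp add: P_add[symmetric] add.commute)
    finally show ?thesis .
  qed
  moreover have "(\<lambda>n. (P (h n) (P t f) \<eta> - P t f \<eta>) / h n) \<longlonglongrightarrow> gen p g (P t f) \<eta>"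
    by (rule filterlim_compose[OF P_derivative h_lim]) (use assms P_Lip in auto)
  moreover have "(\<lambda>n. \<integral>\<zeta>. D n \<zeta> \<partial>(Q t \<eta>)) \<longlonglongrightarrow> (\<integral>\<zeta>. gen p g f \<zeta> \<partial>(Q t \<eta>))"
    by (rule integral_dominated_convergence[OF dominated])
  ultimately have "gen p g (P t f) \<eta> = (\<integral>\<zeta>. gen p g f \<zeta> \<partial>(Q t \<eta>))"
    by (simp add: LIMSEQ_unique)
  with integrable_dominated_convergence[OF dominated] show ?thesis by simp
qed

end

theorem theorem7p2p4:
  fixes p :: "'d::finite site \<Rightarrow> 'd site pmf"
    and g :: "nat \<Rightarrow> real" and a0 :: real
    and K :: "real \<Rightarrow> 'd config \<Rightarrow> 'd config pmf"
    and P :: "real \<Rightarrow> ('d config \<Rightarrow> real) \<Rightarrow> 'd config \<Rightarrow> real"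
    and Q :: "real \<Rightarrow> 'd config \<Rightarrow> 'd config measure"
    and f :: "'d config \<Rightarrow> real" and \<eta> :: "'d config" and s t :: real
  assumes "zero_range_semigroup p g a0 K P Q"
    and "f \<in> Lip p" and "\<eta> \<in> Omega' p" and "s \<ge> 0" and "t \<ge> 0"
  shows "(\<bar>gen p g (P s f) \<eta>\<bar> \<le> 3 * a0 * lip_const p f * exp (4 * a0 * s) * config_norm p \<eta> \<and>
          \<bar>P t f \<eta> - f \<eta>\<bar> \<le>
            3 * a0 * (inverse (4 * a0) * lip_const p f * config_norm p \<eta> * (exp (4 * a0 * t) - 1))) \<and>
         ((\<lambda>h. (P h f \<eta> - f \<eta>) / h) \<longlongrightarrow> gen p g f \<eta>) (at_right 0) \<and>
         (integrable (Q t \<eta>) (gen p g f) \<and>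
          gen p g (P t f) \<eta> = (\<integral>\<zeta>. gen p g f \<zeta> \<partial>(Q t \<eta>)))"
proof -
  interpret zero_range_semigroup p g a0 K P Q by (rule assms(1))
  show ?thesis
    by (intro conjI abs_gen_P_le abs_P_diff_le P_derivative gen_P_commute[THEN conjunct1]
        gen_P_commute[THEN conjunct2] assms(2-5))
qed

end
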